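(* For every integer base $p\ge 2$, $\Sigma_1\text{-}\mathbf{BA}_p \neq \mathbf{BA}_p$. In particular, there exists a fixed regular language $L\subseteq\{0,1\}^*$ such that for every base $p\ge 2$ we have $[\![L]\!]_p\in \mathbf{BA}_p\setminus \Sigma_1\text{-}\mathbf{BA}_p$.
   Context: Fix an integer $p\ge 2$ and let $\Sigma_p=\{0,\dots,p-1\}$. Words over $\Sigma_p$ are read as numbers in base $p$, most significant digit first: for $w=v_m\cdots v_0$ with $v_i\in\Sigma_p$, $[\![w]\!]_p=\sum_{i=0}^m v_i p^i$, and for a language $L\subseteq\Sigma_p^*$ (here $\{0,1\}\subseteq\Sigma_p$), $[\![L]\!]_p=\{[\![w]\!]_p: w\in L\}\subseteq\mathbb{N}$. Büchi arithmetic of base $p$ is the first-order theory of $\langle\mathbb{N},0,1,+,V_p\rangle$, where $V_p(a,b)$ holds iff $a$ is the largest power of $p$ dividing $b$ (i.e. $a=p^k$, $a\mid b$, $pa\nmid b$); $V_p(a,0)$ never holds. $\Sigma_i\text{-}\mathbf{BA}_p$ is the family of sets $\{m\in\mathbb{N}:\Phi(m)\text{ holds}\}$ for $\Sigma_i$-formulas $\Phi(x)$ (prenex, at most $i$ alternating quantifier blocks starting with $\exists$) of Büchi arithmetic of base $p$ with one free variable $x$; $\mathbf{BA}_p=\bigcup_{i\ge1}\Sigma_i\text{-}\mathbf{BA}_p$ is the family of all subsets of $\mathbb{N}$ definable in Büchi arithmetic of base $p$. *)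

theory Defs
  imports Main
begin

section \<open>Words, regular languages and base-\<open>p\<close> values\<close>

text \<open>Words are lists of digits, most significant digit first. The least significant digit is
  \<open>rev w ! 0\<close>, and the empty word has value 0.\<close>

definition word_val :: "nat \<Rightarrow> nat list \<Rightarrow> nat" where
  "word_val p w = (\<Sum>i<length w. rev w ! i * p ^ i)"

definition regular :: "'a set \<Rightarrow> 'a list set \<Rightarrow> bool" where
  "regular A L \<longleftrightarrow>
     (\<exists>(Q :: nat set) q0 F \<delta>. finite Q \<and> q0 \<in> Q \<and> F \<subseteq> Q \<and> (\<forall>q\<in>Q. \<forall>a\<in>A. \<delta> q a \<in> Q) \<and>
        L = {w \<in> lists A. foldl \<delta> q0 w \<in> F})"


section \<open>Buechi arithmetic\<close>

datatype trm = Var nat | Zero | One | Plus trm trm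

datatype fm =
    Equal trm trm
  | V trm trm
  | Neg fm
  | Conj fm fm
  | Disj fm fm
  | Exists nat fm
  | Forall nat fm

primrec eval_trm :: "(nat \<Rightarrow> nat) \<Rightarrow> trm \<Rightarrow> nat" where
  "eval_trm e (Var x) = e x"
| "eval_trm e Zero = 0"
| "eval_trm e One = 1"
| "eval_trm e (Plus s t) = eval_trm e s + eval_trm e t"

text \<open>\<open>V_rel p a b\<close> is never true for \<open>b = 0\<close>, as \<open>p * a\<close> divides 0.\<close>

definition V_rel :: "nat \<Rightarrow> nat \<Rightarrow> nat \<Rightarrow> bool" where
  "V_rel p a b \<longleftrightarrow> (\<exists>k. a = p ^ k) \<and> a dvd b \<and> \<not> p * a dvd b"

primrec sat :: "nat \<Rightarrow> (nat \<Rightarrow> nat) \<Rightarrow> fm \<Rightarrow> bool" where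
  "sat p e (Equal s t) \<longleftrightarrow> eval_trm e s = eval_trm e t"
| "sat p e (V s t) \<longleftrightarrow> V_rel p (eval_trm e s) (eval_trm e t)"
| "sat p e (Neg \<phi>) \<longleftrightarrow> \<not> sat p e \<phi>"
| "sat p e (Conj \<phi> \<psi>) \<longleftrightarrow> sat p e \<phi> \<and> sat p e \<psi>"
| "sat p e (Disj \<phi> \<psi>) \<longleftrightarrow> sat p e \<phi> \<or> sat p e \<psi>"
| "sat p e (Exists x \<phi>) \<longleftrightarrow> (\<exists>n. sat p (e(x := n)) \<phi>)"
| "sat p e (Forall x \<phi>) \<longleftrightarrow> (\<forall>n. sat p (e(x := n)) \<phi>)"

primrec vars_trm :: "trm \<Rightarrow> nat set" where
  "vars_trm (Var x) = {x}"
| "vars_trm Zero = {}"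
| "vars_trm One = {}"
| "vars_trm (Plus s t) = vars_trm s \<union> vars_trm t"

primrec free_vars :: "fm \<Rightarrow> nat set" where
  "free_vars (Equal s t) = vars_trm s \<union> vars_trm t"
| "free_vars (V s t) = vars_trm s \<union> vars_trm t"
| "free_vars (Neg \<phi>) = free_vars \<phi>"
| "free_vars (Conj \<phi> \<psi>) = free_vars \<phi> \<union> free_vars \<psi>"
| "free_vars (Disj \<phi> \<psi>) = free_vars \<phi> \<union> free_vars \<psi>"
| "free_vars (Exists x \<phi>) = free_vars \<phi> - {x}"
| "free_vars (Forall x \<phi>) = free_vars \<phi> - {x}"

primrec qfree :: "fm \<Rightarrow> bool" where
  "qfree (Equal s t) \<longleftrightarrow> True"
| "qfree (V s t) \<longleftrightarrow> True"
| "qfree (Neg \<phi>) \<longleftrightarrow> qfree \<phi>"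
| "qfree (Conj \<phi> \<psi>) \<longleftrightarrow> qfree \<phi> \<and> qfree \<psi>"
| "qfree (Disj \<phi> \<psi>) \<longleftrightarrow> qfree \<phi> \<and> qfree \<psi>"
| "qfree (Exists x \<phi>) \<longleftrightarrow> False"
| "qfree (Forall x \<phi>) \<longleftrightarrow> False"

text \<open>Quantifier blocks may be empty, so \<open>is_Sigma i\<close> is prenex form with at most \<open>i\<close>
  alternating blocks, the first of them existential.\<close>

fun is_Sigma :: "nat \<Rightarrow> fm \<Rightarrow> bool" and is_Pi :: "nat \<Rightarrow> fm \<Rightarrow> bool" where
  "is_Sigma 0 \<phi> \<longleftrightarrow> qfree \<phi>"
| "is_Sigma (Suc i) \<phi> \<longleftrightarrow> (\<exists>xs \<psi>. \<phi> = foldr Exists xs \<psi> \<and> is_Pi i \<psi>)"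
| "is_Pi 0 \<phi> \<longleftrightarrow> qfree \<phi>"
| "is_Pi (Suc i) \<phi> \<longleftrightarrow> (\<exists>xs \<psi>. \<phi> = foldr Forall xs \<psi> \<and> is_Sigma i \<psi>)"

text \<open>Only the value of \<open>x\<close> matters in the environment below, because no other variable
  is free in \<open>\<phi>\<close>.\<close>

definition Sigma_BA :: "nat \<Rightarrow> nat \<Rightarrow> nat set set" where
  "Sigma_BA i p =
     {{m. sat p ((\<lambda>_. 0)(x := m)) \<phi>} | x \<phi>. is_Sigma i \<phi> \<and> free_vars \<phi> \<subseteq> {x}}"

definition BA :: "nat \<Rightarrow> nat set set" where
  "BA p = (\<Union>i\<in>{1..}. Sigma_BA i p)"

end

theory Submission
  imports Defs "HOL-Computational_Algebra.Primes"
begin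

text \<open>
  The language \<open>{00, 01}\<^sup>*\<close> describes the numbers whose digits in base \<open>p\<^sup>2\<close> are 0 or 1. This set
  contains no two distinct numbers together with their midpoint, because adding two such numbers
  produces no carry. It has \<open>2\<^sup>N\<close> elements below \<open>p\<^bsup>2N\<^esup>\<close>.

  On the other hand, cut each value of an assignment into its \<open>n\<close> low digits and a high part.
  If the low parts of two satisfying assignments of a quantifier-free formula agree in finitely
  many features (parities, carries into position \<open>n\<close>, comparisons, and for each \<open>V\<close>-atom the
  position of the last nonzero digit), then the midpoints of the low parts with the high parts of
  the first assignment satisfy the formula as well. The features take only polynomially many values
  in \<open>n\<close>, so an existentially definable set with so many elements contains two distinct numbers
  together with their midpoint.
\<close>

section \<open>Numbers with digits 0 and 1\<close>

inductive_set zero_one :: "nat \<Rightarrow> nat set" for q where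
  zero: "0 \<in> zero_one q"
| digit: "x \<in> zero_one q \<Longrightarrow> b \<le> 1 \<Longrightarrow> q * x + b \<in> zero_one q"

lemma zero_one_iff:
  assumes "q \<ge> 2"
  shows "x \<in> zero_one q \<longleftrightarrow> x mod q \<le> 1 \<and> x div q \<in> zero_one q"
proof
  assume "x \<in> zero_one q"
  then show "x mod q \<le> 1 \<and> x div q \<in> zero_one q"
    using assms by cases (auto simp: zero_one.zero)
next
  assume "x mod q \<le> 1 \<and> x div q \<in> zero_one q"
  then have "q * (x div q) + x mod q \<in> zero_one q"
    by (blast intro: zero_one.digit)
  then show "x \<in> zero_one q" by simp
qed

text \<open>Last digits add up to at most 2 on both sides, so \<open>q >= 3\<close> rules out
  carries and the equation holds digit by digit; there 0 + 0 and 1 + 1 are the only even sums. For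
  \<open>q = 2\<close> every number belongs to \<open>zero_one q\<close>, which is why base
  \<open>p\<^sup>2\<close> is used below.\<close>

lemma zero_one_no_midpoint:
  assumes "q \<ge> 3" "x \<in> zero_one q" "y \<in> zero_one q" "z \<in> zero_one q" "x + y = 2 * z"
  shows "x = y"
  using assms(2-5)
proof (induction "x + y + z" arbitrary: x y z rule: less_induct)
  case less
  let ?d = "\<lambda>x. x div q" and ?m = "\<lambda>x. x mod q"
  have "q \<ge> 2" using assms(1) by simp
  then have m: "?m x \<le> 1" "?m y \<le> 1" "?m z \<le> 1"
    and d: "?d x \<in> zero_one q" "?d y \<in> zero_one q" "?d z \<in> zero_one q"
    using less.prems(1-3) zero_one_iff by blast+
  have e: "x = q * ?d x + ?m x" "y = q * ?d y + ?m y" "z = q * ?d z + ?m z" by simp_all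
  have "q * (?d x + ?d y) + (?m x + ?m y) = (q * ?d x + ?m x) + (q * ?d y + ?m y)"
    by (simp only: distrib_left add_ac)
  also have "\<dots> = 2 * (q * ?d z + ?m z)" using less.prems(4) by simp
  finally have eq: "q * (?d x + ?d y) + (?m x + ?m y) = q * (2 * ?d z) + 2 * ?m z"
    by (simp only: distrib_left mult.left_commute)
  have "(q * (?d x + ?d y) + (?m x + ?m y)) mod q = (q * (2 * ?d z) + 2 * ?m z) mod q"
    by (simp only: eq)
  then have "(?m x + ?m y) mod q = (2 * ?m z) mod q" by (simp only: mod_mult_self4)
  moreover have "?m x + ?m y < q" "2 * ?m z < q" using m assms(1) by linarith+
  ultimately have mm: "?m x + ?m y = 2 * ?m z" by (metis mod_less)
  then have dd: "?d x + ?d y = 2 * ?d z" using eq assms(1) by simp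
  show ?case
  proof (cases "x + y + z = 0")
    case False
    have "?d x \<le> x" "?d y \<le> y" "?d z \<le> z" by simp_all
    moreover have "?d x < x \<or> ?d y < y \<or> ?d z < z" using False assms(1) by auto
    ultimately have "?d x + ?d y + ?d z < x + y + z" by linarith
    from less.hyps[OF this d dd] have "?d x = ?d y" .
    moreover have "?m x = ?m y" using mm m by (cases "?m z = 0") linarith+
    ultimately show ?thesis using e by metis
  qed simp
qed

lemma card_zero_one_ge:
  assumes "q \<ge> 2"
  shows "2 ^ N \<le> card (zero_one q \<inter> {..<q ^ N})"
proof (induction N)
  case 0
  have "zero_one q \<inter> {..<q ^ 0} = {0}" by (auto intro: zero_one.zero)
  then show ?case by simp
next
  case (Suc N)
  let ?A = "zero_one q \<inter> {..<q ^ N}" and ?f = "\<lambda>(x, b). q * x + b"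
  have "inj_on ?f (?A \<times> {..1})"
  proof (rule inj_onI)
    fix u v assume "u \<in> ?A \<times> {..1}" "v \<in> ?A \<times> {..1}" "?f u = ?f v"
    moreover obtain x b y c where [simp]: "u = (x, b)" "v = (y, c)" by fastforce
    ultimately have *: "q * x + b = q * y + c" "b < q" "c < q" using assms by auto
    have "(q * x + b) div q = x" "(q * y + c) div q = y" using *(2,3) by simp_all
    then show "u = v" using * by simp
  qed
  then have "card (?f ` (?A \<times> {..1})) = card ?A * 2" by (simp add: card_image card_cartesian_product)
  moreover have "?f ` (?A \<times> {..1}) \<subseteq> zero_one q \<inter> {..<q ^ Suc N}"
  proof safe
    fix x b :: nat assume *: "x \<in> zero_one q" "x < q ^ N" "b \<le> 1"
    then show "q * x + b \<in> zero_one q" by (simp add: zero_one.digit)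
    have "q * (x + 1) \<le> q * q ^ N" using * by (intro mult_le_mono) auto
    then show "q * x + b < q ^ Suc N" using * assms by simp
  qed
  then have "card (?f ` (?A \<times> {..1})) \<le> card (zero_one q \<inter> {..<q ^ Suc N})"
    by (intro card_mono) auto
  ultimately show ?case using Suc by simp
qed

text \<open>A base \<open>p\<^sup>2\<close> digit is at most 1 iff its upper base \<open>p\<close>
  digit is 0 and its lower one is at most 1. This form speaks of one position at a time, as the
  defining formula will.\<close>

lemma zero_one_square_iff:
  assumes "p \<ge> 2"
  shows "x \<in> zero_one (p\<^sup>2) \<longleftrightarrow> (\<forall>k. x div p ^ k mod p = 0 \<or> x div p ^ k mod p = 1 \<and> even k)"
    (is "_ \<longleftrightarrow> ?D x")
proof (induction x rule: less_induct)
  case (less x)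
  have q: "p\<^sup>2 \<ge> 2" using assms by (simp add: power2_eq_square mult_le_mono[of 1 p 2 p, simplified])
  \<comment> \<open>Splitting off positions 0 and 1 shifts the others by 2, which keeps the parity
    of \<open>k\<close>.\<close>
  have shift: "(\<forall>k. P k) \<longleftrightarrow> P 0 \<and> P 1 \<and> (\<forall>k. P (k + 2))" for P :: "nat \<Rightarrow> bool"
    by (metis One_nat_def add_2_eq_Suc' not0_implies_Suc)
  have "x div p ^ (k + 2) = x div p\<^sup>2 div p ^ k" for k
    by (simp add: div_mult2_eq power_add power2_eq_square mult.commute)
  then have D: "?D x \<longleftrightarrow> x mod p \<le> 1 \<and> x div p mod p = 0 \<and> ?D (x div p\<^sup>2)"
    by (subst shift) (auto simp: le_Suc_eq)
  have "x mod p\<^sup>2 = p * (x div p mod p) + x mod p"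
    by (simp add: power2_eq_square mod_mult2_eq)
  moreover have "p * d + r \<le> 1 \<longleftrightarrow> r \<le> 1 \<and> d = 0" for d r
    using assms by (cases d) auto
  ultimately have "x mod p\<^sup>2 \<le> 1 \<longleftrightarrow> x mod p \<le> 1 \<and> x div p mod p = 0" by simp
  moreover have "x div p\<^sup>2 \<in> zero_one (p\<^sup>2) \<longleftrightarrow> ?D (x div p\<^sup>2)"
  proof (cases "x = 0")
    case False
    then show ?thesis using q by (intro less) simp
  qed (auto intro: zero_one.zero)
  ultimately show ?case unfolding D zero_one_iff[OF q, of x] by (simp only: conj_assoc)
qed

section \<open>The regular language\<close>

text \<open>State 0 lies between blocks and accepts, state 1 follows the leading 0 of a block, and
  state 2 is dead.\<close>

definition parity_step :: "nat \<Rightarrow> nat \<Rightarrow> nat" where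
  "parity_step s a = (if s = 0 then if a = 0 then 1 else 2 else if s = 1 then 0 else 2)"

text \<open>The language \<open>{00, 01}\<^sup>*\<close>.\<close>

definition padded :: "nat list set" where
  "padded = {w \<in> lists {0, 1}. foldl parity_step 0 w \<in> {0}}"

lemma regular_padded: "regular {0, 1} padded"
  unfolding regular_def padded_def
  by (rule exI[of _ "{0, 1, 2}"], rule exI[of _ 0], rule exI[of _ "{0}"],
      rule exI[of _ parity_step]) (auto simp: parity_step_def)

lemma word_val_Nil [simp]: "word_val p [] = 0"
  by (simp add: word_val_def)

lemma word_val_snoc [simp]: "word_val p (w @ [a]) = p * word_val p w + a"
  unfolding word_val_def
  by (simp del: sum.lessThan_Suc add: sum.lessThan_Suc_shift sum_distrib_left mult.left_commute)

lemma word_val_padded: "word_val p ` padded = zero_one (p\<^sup>2)"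
proof safe
  \<comment> \<open>In state 1 half a block has been read: its 0 has contributed one factor
    \<open>p\<close>, and the next digit completes a base \<open>p\<^sup>2\<close> digit.\<close>
  have "(foldl parity_step 0 w = 0 \<longrightarrow> word_val p w \<in> zero_one (p\<^sup>2)) \<and>
        (foldl parity_step 0 w = 1 \<longrightarrow> (\<exists>z\<in>zero_one (p\<^sup>2). word_val p w = p * z))"
    if "w \<in> lists {0, 1}" for w
    using that
  proof (induction w rule: rev_induct)
    case (snoc a w)
    have "p * (p * z) + a \<in> zero_one (p\<^sup>2)" if "z \<in> zero_one (p\<^sup>2)" for z
      using zero_one.digit[OF that, of a] snoc.prems by (auto simp: power2_eq_square mult.assoc)
    with snoc show ?case by (auto simp: parity_step_def)
  qed (simp add: zero_one.zero)
  then show "word_val p w \<in> zero_one (p\<^sup>2)" if "w \<in> padded" for w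
    using that by (simp add: padded_def)
next
  fix x assume "x \<in> zero_one (p\<^sup>2)"
  then show "x \<in> word_val p ` padded"
  proof induction
    case zero
    have "[] \<in> padded" by (simp add: padded_def)
    then show ?case by (force intro: image_eqI[of _ _ "[]"])
  next
    case (digit x b)
    then obtain w where w: "w \<in> padded" "x = word_val p w" by blast
    then have "(w @ [0]) @ [b] \<in> padded" using digit(2) by (auto simp: padded_def parity_step_def)
    moreover have "word_val p ((w @ [0]) @ [b]) = p\<^sup>2 * x + b"
      unfolding word_val_snoc using w(2) by (simp add: power2_eq_square mult.assoc)
    ultimately show ?case by (metis image_eqI)
  qed
qed

section \<open>Definability\<close>

lemma V_rel_power:
  assumes "p \<ge> 2"
  shows "V_rel p (p ^ k) b \<longleftrightarrow> p ^ k dvd b \<and> \<not> p ^ Suc k dvd b"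
  using assms by (auto simp: V_rel_def)

text \<open>Modulo \<open>p\<^sup>2 - 1\<close> even powers of \<open>p\<close> are 1 and odd ones
  are \<open>p\<close>, and \<open>1 < p < p\<^sup>2 - 1\<close>. Thus the parity of an exponent
  becomes a linear condition.\<close>

lemma even_power_iff:
  assumes "(p::nat) \<ge> 2"
  shows "(\<exists>t. p ^ k = 1 + (p\<^sup>2 - 1) * t) \<longleftrightarrow> even k"
proof -
  have p: "p\<^sup>2 = Suc (p\<^sup>2 - 1)" using assms by simp
  have ev: "\<exists>t. p ^ (2 * j) = 1 + (p\<^sup>2 - 1) * t" for j
  proof (induction j)
    case (Suc j)
    then obtain t where t: "p ^ (2 * j) = 1 + (p\<^sup>2 - 1) * t" by blast
    have "p ^ (2 * Suc j) = p\<^sup>2 * p ^ (2 * j)" by (simp add: power2_eq_square)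
    also have "\<dots> = (1 + (p\<^sup>2 - 1)) * (1 + (p\<^sup>2 - 1) * t)" using t p by simp
    also have "\<dots> = 1 + (p\<^sup>2 - 1) * (1 + t + (p\<^sup>2 - 1) * t)" by (simp add: algebra_simps)
    finally show ?case by blast
  qed simp
  have "\<not> (\<exists>t. p ^ (2 * j + 1) = 1 + (p\<^sup>2 - 1) * t)" for j
  proof
    assume "\<exists>t. p ^ (2 * j + 1) = 1 + (p\<^sup>2 - 1) * t"
    then obtain t where t: "p ^ (2 * j + 1) = 1 + (p\<^sup>2 - 1) * t" by blast
    obtain s where s: "p ^ (2 * j) = 1 + (p\<^sup>2 - 1) * s" using ev by blast
    have *: "p + (p\<^sup>2 - 1) * (p * s) = 1 + (p\<^sup>2 - 1) * t"
      using t s by (simp add: algebra_simps)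
    have "2 * p \<le> p\<^sup>2" using assms by (simp add: power2_eq_square)
    then have lt: "p < p\<^sup>2 - 1" using assms by linarith
    have "(p + (p\<^sup>2 - 1) * (p * s)) mod (p\<^sup>2 - 1) = (1 + (p\<^sup>2 - 1) * t) mod (p\<^sup>2 - 1)"
      by (simp only: *)
    then have "p mod (p\<^sup>2 - 1) = 1 mod (p\<^sup>2 - 1)" by (simp only: mod_mult_self2)
    then show False using lt assms by simp
  qed
  then show ?thesis by (metis ev evenE oddE)
qed

primrec times_trm :: "nat \<Rightarrow> trm \<Rightarrow> trm" where
  "times_trm 0 t = Zero"
| "times_trm (Suc k) t = Plus t (times_trm k t)"

lemma eval_times_trm [simp]: "eval_trm e (times_trm k t) = k * eval_trm e t"
  by (induction k) auto

lemma vars_times_trm: "vars_trm (times_trm k t) \<subseteq> vars_trm t"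
  by (induction k) auto

text \<open>With \<open>x = Var 0\<close>, \<open>u = Var 1\<close>, \<open>a = Var 2\<close>, \<open>c = Var 3\<close>: whenever \<open>x = a + u + c\<close> splits \<open>x\<close>
  at a nonzero digit in position \<open>u\<close> (with \<open>a < u\<close> the part below it), that digit is 1,
  which means that \<open>c\<close> has a zero there, and \<open>u\<close> is an even power of \<open>p\<close>, which means
  that it is 1 modulo \<open>p\<^sup>2 - 1\<close>.\<close>

definition digits_matrix :: "nat \<Rightarrow> fm" where
  "digits_matrix p =
     Disj (Neg (Conj (Equal (Var 0) (Plus (Var 2) (Plus (Var 1) (Var 3))))
                  (Conj (Equal (Var 1) (Plus (Var 2) (Plus (Var 4) One)))
                        (V (Var 1) (Plus (Var 1) (Var 3))))))
       (Conj (Neg (V (Var 1) (Var 3)))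
             (Equal (Var 1) (Plus One (times_trm (p\<^sup>2 - 1) (Var 5)))))"

text \<open>\<open>Var 4\<close> is the slack expressing \<open>a < u\<close>; it occurs in the
  premise of the implication, hence is universal. \<open>Var 5\<close> is the quotient in the
  congruence, hence existential.\<close>

definition digits_fm :: "nat \<Rightarrow> fm" where
  "digits_fm p = foldr Forall [1, 2, 3, 4] (foldr Exists [5] (digits_matrix p))"

lemma sat_digits_fm:
  assumes "p \<ge> 2"
  shows "sat p ((\<lambda>_. 0)(0 := m)) (digits_fm p) \<longleftrightarrow> m \<in> zero_one (p\<^sup>2)"
proof -
  have lt: "a < u \<longleftrightarrow> (\<exists>s. u = a + (s + 1))" for a u :: nat
    by (auto simp: less_iff_Suc_add)
  have "sat p ((\<lambda>_. 0)(0 := m)) (digits_fm p) \<longleftrightarrow>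
    (\<forall>u a c s. \<exists>t. \<not> (m = a + (u + c) \<and> u = a + (s + 1) \<and> V_rel p u (u + c)) \<or>
        \<not> V_rel p u c \<and> u = 1 + (p\<^sup>2 - 1) * t)"
    by (simp add: digits_fm_def digits_matrix_def)
  also have "\<dots> \<longleftrightarrow> (\<forall>u a c. m = a + (u + c) \<and> a < u \<and> V_rel p u (u + c) \<longrightarrow>
        \<not> V_rel p u c \<and> (\<exists>t. u = 1 + (p\<^sup>2 - 1) * t))" (is "_ \<longleftrightarrow> ?S")
    unfolding lt by blast
  also have "?S \<longleftrightarrow> (\<forall>k a c. m = a + (p ^ k + c) \<and> a < p ^ k \<and> V_rel p (p ^ k) (p ^ k + c) \<longrightarrow>
        \<not> V_rel p (p ^ k) c \<and> even k)" (is "_ \<longleftrightarrow> (\<forall>k. ?E k)")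
  proof -
    \<comment> \<open>The premise forces \<open>u\<close> to be a power of \<open>p\<close>, so
      positions \<open>k\<close> can replace \<open>u\<close>.\<close>
    have "\<exists>k. u = p ^ k" if "V_rel p u b" for u b using that by (auto simp: V_rel_def)
    then show ?thesis using even_power_iff[OF assms] by metis
  qed
  finally have "sat p ((\<lambda>_. 0)(0 := m)) (digits_fm p) \<longleftrightarrow> (\<forall>k. ?E k)" .
  moreover have "?E k \<longleftrightarrow> m div p ^ k mod p = 0 \<or> m div p ^ k mod p = 1 \<and> even k" for k
  proof -
    let ?P = "p ^ k"
    have P: "?P > 0" using assms by simp
    have V: "V_rel p ?P (?P * j) \<longleftrightarrow> j mod p \<noteq> 0" for j
      using P assms by (simp add: V_rel_power dvd_eq_mod_eq_0 mult.commute[of p])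
    have "?E k \<longleftrightarrow> (\<forall>a j. m = a + ?P * (1 + j) \<and> a < ?P \<and> V_rel p ?P (?P * (1 + j)) \<longrightarrow>
        \<not> V_rel p ?P (?P * j) \<and> even k)" (is "_ \<longleftrightarrow> ?R")
    proof
      assume ?R
      show "?E k"
      proof (intro allI impI)
        fix a c assume *: "m = a + (?P + c) \<and> a < ?P \<and> V_rel p ?P (?P + c)"
        \<comment> \<open>Once \<open>c = ?P * j\<close>, the digit of \<open>m\<close> at position
          \<open>k\<close> is \<open>(1 + j) mod p\<close>.\<close>
        then have "?P dvd c" by (simp add: V_rel_def)
        then obtain j where j: "c = ?P * j" by blast
        have "m = a + ?P * (1 + j) \<and> a < ?P \<and> V_rel p ?P (?P * (1 + j))" using * j by simp
        with \<open>?R\<close> show "\<not> V_rel p ?P c \<and> even k" unfolding j by blast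
      qed
    qed (simp only: distrib_left mult_1_right, blast)
    also have "\<dots> \<longleftrightarrow> (\<forall>a j. m = a + ?P * (1 + j) \<and> a < ?P \<and> (1 + j) mod p \<noteq> 0 \<longrightarrow>
        j mod p = 0 \<and> even k)" by (simp only: V not_not)
    also have "\<dots> \<longleftrightarrow> (\<forall>j. m div ?P = 1 + j \<and> (1 + j) mod p \<noteq> 0 \<longrightarrow> j mod p = 0 \<and> even k)"
    proof -
      have "(\<exists>a. m = a + ?P * i \<and> a < ?P) \<longleftrightarrow> m div ?P = i" for i
      proof
        assume "m div ?P = i"
        then have "m = m mod ?P + ?P * i \<and> m mod ?P < ?P" using P by auto
        then show "\<exists>a. m = a + ?P * i \<and> a < ?P" by blast
      qed (use P in auto)
      then show ?thesis by blast
    qed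
    also have "\<dots> \<longleftrightarrow> m div ?P mod p = 0 \<or> m div ?P mod p = 1 \<and> even k"
    proof (cases "m div ?P")
      case (Suc j)
      have "Suc j mod p = 1 \<longleftrightarrow> j mod p = 0" using assms
        by (auto simp: mod_Suc)
      then show ?thesis using Suc by auto
    qed simp
    finally show ?thesis .
  qed
  ultimately show ?thesis by (simp only: zero_one_square_iff[OF assms])
qed

lemma zero_one_in_BA:
  assumes "p \<ge> 2"
  shows "zero_one (p\<^sup>2) \<in> BA p"
proof -
  have "is_Sigma 1 (foldr Exists [5] (digits_matrix p))"
    by (auto simp: digits_matrix_def simp del: foldr.simps intro!: exI)
  then have "is_Pi 2 (digits_fm p)"
    unfolding digits_fm_def numeral_2_eq_2 One_nat_def is_Pi.simps(2) by blast
  \<comment> \<open>An empty existential block in front raises level 2 of the Pi hierarchy to level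
    3 of the Sigma hierarchy.\<close>
  then have "is_Sigma 3 (digits_fm p)"
    unfolding numeral_3_eq_3 numeral_2_eq_2 is_Sigma.simps(2)
    by (intro exI[of _ "[]"]) simp
  moreover have "free_vars (digits_fm p) \<subseteq> {0}"
    using vars_times_trm[of "p\<^sup>2 - 1" "Var 5"]
    by (auto simp: digits_fm_def digits_matrix_def)
  moreover have "zero_one (p\<^sup>2) = {m. sat p ((\<lambda>_. 0)(0 := m)) (digits_fm p)}"
    by (simp add: sat_digits_fm[OF assms])
  ultimately have "zero_one (p\<^sup>2) \<in> Sigma_BA 3 p" unfolding Sigma_BA_def by blast
  then show ?thesis by (auto simp: BA_def)
qed

section \<open>Midpoints of satisfying assignments\<close>

text \<open>Here \<open>p\<close> may be composite: \<open>multiplicity\<close> serves only as the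
  largest exponent \<open>k\<close> with \<open>p ^ k dvd b\<close>.\<close>

lemma V_rel_iff_multiplicity:
  assumes "p \<ge> 2" "b > 0"
  shows "V_rel p a b \<longleftrightarrow> a = p ^ multiplicity p b"
proof -
  have "p ^ k dvd b \<longleftrightarrow> k \<le> multiplicity p b" for k
    using assms by (intro power_dvd_iff_le_multiplicity) auto
  then show ?thesis
    using assms V_rel_power[OF assms(1), of _ b] unfolding V_rel_def
    by (metis Suc_n_not_le_n not_less_eq_eq order_antisym order_refl power_Suc)
qed

text \<open>A power of \<open>p\<close> has a single nonzero digit. It must sit where the second
  argument has its last nonzero digit: in the low part unless \<open>s = 0\<close>, and then in the
  high part.\<close>

lemma V_rel_split:
  assumes "p \<ge> 2" "r < p ^ n" "s < p ^ n"
  shows "V_rel p (r + p ^ n * h) (s + p ^ n * g) \<longleftrightarrow>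
    (if s = 0 then r = 0 \<and> V_rel p h g else h = 0 \<and> V_rel p r s)"
proof (cases "s = 0")
  case True
  have P: "p ^ n > 0" using assms by simp
  have "r = 0 \<and> V_rel p h g" if V: "V_rel p (r + p ^ n * h) (p ^ n * g)"
  proof -
    obtain k where k: "r + p ^ n * h = p ^ k" using V by (auto simp: V_rel_def)
    have d: "p ^ k dvd p ^ n * g" "\<not> p ^ Suc k dvd p ^ n * g"
      using V V_rel_power[OF assms(1)] k by auto
    have "n \<le> k" using d(2) by (metis dvd_mult2 le_imp_power_dvd not_less_eq_eq)
    then obtain j where j: "k = n + j" using le_Suc_ex by blast
    have e: "r + p ^ n * h = p ^ n * p ^ j" using k j by (simp add: power_add)
    then have "p ^ n dvd r" by (metis dvd_add_left_iff dvd_triv_left)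
    then have "r = 0" using assms(2) by (auto dest: dvd_imp_le)
    moreover have "h = p ^ j" using e \<open>r = 0\<close> P assms(1) by simp
    moreover have "p ^ j dvd g \<and> \<not> p ^ Suc j dvd g"
      using d P assms(1) unfolding j by (simp add: power_add mult.left_commute[of p])
    ultimately show ?thesis using V_rel_power[OF assms(1)] by simp
  qed
  moreover have "V_rel p (p ^ n * h) (p ^ n * g)" if V: "V_rel p h g"
  proof -
    obtain k where k: "h = p ^ k" using V by (auto simp: V_rel_def)
    then have "p ^ k dvd g \<and> \<not> p ^ Suc k dvd g" using V V_rel_power[OF assms(1)] by auto
    then have "V_rel p (p ^ (n + k)) (p ^ n * g)" using P assms(1)
      unfolding V_rel_power[OF assms(1)] by (simp add: power_add mult.left_commute[of p])
    then show ?thesis by (simp add: k power_add)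
  qed
  ultimately show ?thesis using True by auto
next
  case False
  have dv: "p ^ k dvd s + p ^ n * g \<longleftrightarrow> p ^ k dvd s" if "k \<le> n" for k
    using that by (metis dvd_add_left_iff dvd_mult2 le_imp_power_dvd)
  have ns: "\<not> p ^ n dvd s" using False assms(3) by (auto dest: dvd_imp_le)
  then have ns': "\<not> p ^ n dvd s + p ^ n * g" using dv by simp
  have lt: "k < n" if "p ^ k dvd b" "\<not> p ^ n dvd b" for k b
    using that by (metis dvd_trans le_imp_power_dvd not_le_imp_less)
  \<comment> \<open>A power below \<open>p ^ n\<close> leaves no room for a nonzero high
    part.\<close>
  have pl: "r + p ^ n * h = p ^ k \<longleftrightarrow> h = 0 \<and> r = p ^ k" if "k < n" for k
  proof -
    have "p ^ k < p ^ n" using that assms(1) by simp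
    then show ?thesis by (cases h) auto
  qed
  have "V_rel p (r + p ^ n * h) (s + p ^ n * g) \<longleftrightarrow>
      (\<exists>k<n. r + p ^ n * h = p ^ k \<and> p ^ k dvd s + p ^ n * g \<and> \<not> p ^ Suc k dvd s + p ^ n * g)"
    unfolding V_rel_def using lt ns' by (metis power_Suc)
  also have "\<dots> \<longleftrightarrow> (\<exists>k<n. h = 0 \<and> r = p ^ k \<and> p ^ k dvd s \<and> \<not> p ^ Suc k dvd s)"
    using dv pl by (metis Suc_leI less_imp_le)
  also have "\<dots> \<longleftrightarrow> h = 0 \<and> V_rel p r s"
    unfolding V_rel_def using lt ns by (metis power_Suc)
  finally show ?thesis using False by simp
qed

section \<open>Comparisons and valuations under midpoints\<close>

definition cmp :: "nat \<Rightarrow> nat \<Rightarrow> nat" where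
  "cmp a b = (if a < b then 0 else if a = b then 1 else 2)"

lemma cmp_le: "cmp a b \<le> 2"
  by (simp add: cmp_def)

text \<open>Two strict inequalities in the same direction add up to a strict one, and even sums are
  halved exactly.\<close>

lemma cmp_midpoint:
  assumes "cmp a b = cmp a' b'" "even (a + a')" "even (b + b')"
  shows "(a + a') div 2 = (b + b') div 2 \<longleftrightarrow> a = b"
  using assms by (auto simp: cmp_def elim!: evenE split: if_splits)

text \<open>If both cofactors are \<open>c\<close> modulo \<open>2 * p\<close>, their half-sum is
  still \<open>c\<close> modulo \<open>p\<close>, and \<open>p\<close> does not divide
  \<open>c\<close>.\<close>

lemma multiplicity_midpoint:
  fixes p s s' k :: nat
  assumes "p \<ge> 2" "s > 0" "s' > 0" "multiplicity p s = k" "multiplicity p s' = k"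
    and "s div p ^ k mod (2 * p) = s' div p ^ k mod (2 * p)"
  shows "multiplicity p ((s + s') div 2) = k"
proof -
  let ?q = "s div p ^ k" and ?q' = "s' div p ^ k"
  have s: "s = p ^ k * ?q" "s' = p ^ k * ?q'"
    using multiplicity_dvd[of p s] multiplicity_dvd[of p s'] assms(4,5) by simp_all
  have dv: "p ^ i dvd s \<longleftrightarrow> i \<le> k" for i
    using assms(1,2,4) power_dvd_iff_le_multiplicity[of s p i] by auto
  have "\<not> p dvd ?q"
  proof
    assume "p dvd ?q"
    then have "p ^ k * p dvd p ^ k * ?q" by (intro mult_dvd_mono) simp_all
    then have "p ^ Suc k dvd s" using s(1) by (simp add: mult.commute)
    then show False unfolding dv by simp
  qed
  define c where "c = ?q mod (2 * p)"
  obtain i j where ij: "?q = c + 2 * p * i" "?q' = c + 2 * p * j"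
    using assms(6) by (metis c_def mod_mult_div_eq)
  have "\<not> p dvd c" using \<open>\<not> p dvd ?q\<close> ij(1) by (metis dvd_add dvd_mult2 dvd_triv_right)
  have "s + s' = 2 * (p ^ k * (c + p * (i + j)))"
    using s unfolding ij by (simp add: algebra_simps)
  then have m: "(s + s') div 2 = p ^ k * (c + p * (i + j))" by simp
  have "\<not> p dvd c + p * (i + j)" using \<open>\<not> p dvd c\<close> by (metis dvd_add_left_iff dvd_triv_left)
  then show ?thesis unfolding m using assms(1)
    by (intro multiplicity_eqI) (auto simp: mult.commute)
qed

section \<open>Features of an assignment and their bounds\<close>

definition carry :: "nat \<Rightarrow> nat \<Rightarrow> trm \<Rightarrow> (nat \<Rightarrow> nat) \<Rightarrow> nat" where
  "carry p n t f = eval_trm f t div p ^ n"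

definition rest :: "nat \<Rightarrow> nat \<Rightarrow> trm \<Rightarrow> (nat \<Rightarrow> nat) \<Rightarrow> nat" where
  "rest p n t f = eval_trm f t mod p ^ n"

text \<open>The remainder modulo \<open>2 * p\<close> fixes both the last nonzero digit and the parity that
  makes it survive taking the midpoint. If the rest of \<open>t\<close> is 0, then \<open>multiplicity\<close> returns
  the junk value 0, which is harmless as the comparison with 0 is recorded separately.\<close>

primrec feats :: "nat \<Rightarrow> nat \<Rightarrow> fm \<Rightarrow> (nat \<Rightarrow> nat) \<Rightarrow> nat list" where
  "feats p n (Equal s t) f =
     [carry p n s f, carry p n t f, cmp (rest p n s f) (rest p n t f)]"
| "feats p n (V s t) f =
     [carry p n s f, carry p n t f, cmp (rest p n s f) 0, cmp (rest p n t f) 0,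
      multiplicity p (rest p n t f),
      rest p n t f div p ^ multiplicity p (rest p n t f) mod (2 * p),
      cmp (rest p n s f) (p ^ multiplicity p (rest p n t f))]"
| "feats p n (Neg \<phi>) f = feats p n \<phi> f"
| "feats p n (Conj \<phi> \<psi>) f = feats p n \<phi> f @ feats p n \<psi> f"
| "feats p n (Disj \<phi> \<psi>) f = feats p n \<phi> f @ feats p n \<psi> f"
| "feats p n (Exists x \<phi>) f = []"
| "feats p n (Forall x \<phi>) f = []"

text \<open>Fixed lengths let an equality of appended feature lists be split, and make the lists
  countable by length.\<close>

lemma length_feats: "length (feats p n \<psi> f) = length (feats p' n' \<psi> f')"
  by (induction \<psi>) auto

lemma eval_trm_le: "(\<And>v. f v \<le> b) \<Longrightarrow> 1 \<le> b \<Longrightarrow> eval_trm f t \<le> Suc (size t) * b"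
proof (induction t)
  case (Plus s t)
  then have "eval_trm f s + eval_trm f t \<le> Suc (size s) * b + Suc (size t) * b" by (intro add_mono) auto
  then show ?case by (simp add: algebra_simps)
qed auto

lemma carry_le:
  assumes "p \<ge> 2" "\<And>v. f v < p ^ n"
  shows "carry p n t f \<le> Suc (size t)"
proof -
  have "eval_trm f t \<le> Suc (size t) * p ^ n" using assms by (intro eval_trm_le) (auto intro: less_imp_le)
  then have "eval_trm f t div p ^ n \<le> Suc (size t) * p ^ n div p ^ n" by (rule div_le_mono)
  then show ?thesis using assms(1) by (simp add: carry_def)
qed

lemma multiplicity_le_of_less_power:
  fixes p r n :: nat
  assumes "p \<ge> 2" "r < p ^ n"
  shows "multiplicity p r \<le> n"
proof (cases "r = 0")
  case False
  then have "p ^ multiplicity p r \<le> r" by (intro dvd_imp_le multiplicity_dvd) simp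
  then have "p ^ multiplicity p r < p ^ n" using assms(2) by (rule le_less_trans)
  then show ?thesis using assms(1) by simp
qed simp

text \<open>Carries are bounded by term sizes, comparisons by 2 and residues by
  \<open>2 * p\<close>; only the multiplicities grow with \<open>n\<close>, at most
  linearly.\<close>

lemma feats_le:
  assumes "p \<ge> 2"
  shows "\<exists>C. \<forall>n f. (\<forall>v. f v < p ^ n) \<longrightarrow> set (feats p n \<psi> f) \<subseteq> {..C + n}"
proof (induction \<psi>)
  case (Equal s t)
  have "set (feats p n (Equal s t) f) \<subseteq> {..(size s + size t + 3) + n}" if "\<forall>v. f v < p ^ n" for n f
    using carry_le[OF assms, of f n s] carry_le[OF assms, of f n t] that
      cmp_le[of "rest p n s f" "rest p n t f"] by simp
  then show ?case by blast
next
  case (V s t)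
  have "set (feats p n (V s t) f) \<subseteq> {..(size s + size t + 3 + 2 * p) + n}" if "\<forall>v. f v < p ^ n" for n f
  proof -
    have "rest p n t f < p ^ n" using assms by (simp add: rest_def)
    from multiplicity_le_of_less_power[OF assms this]
    have "multiplicity p (rest p n t f) \<le> n" .
    moreover have "rest p n t f div p ^ multiplicity p (rest p n t f) mod (2 * p) < 2 * p"
      using assms by simp
    moreover have "carry p n s f \<le> Suc (size s)" "carry p n t f \<le> Suc (size t)"
      using carry_le[OF assms, of f n] that by auto
    ultimately show ?thesis
      using cmp_le[of "rest p n s f" 0] cmp_le[of "rest p n t f" 0]
        cmp_le[of "rest p n s f" "p ^ multiplicity p (rest p n t f)"]
      by simp
  qed
  then show ?case by blast
next
  case (Conj \<phi> \<psi>)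
  then obtain C D where
    "\<forall>n f. (\<forall>v. f v < p ^ n) \<longrightarrow> set (feats p n \<phi> f) \<subseteq> {..C + n}"
    "\<forall>n f. (\<forall>v. f v < p ^ n) \<longrightarrow> set (feats p n \<psi> f) \<subseteq> {..D + n}" by blast
  then have "\<forall>n f. (\<forall>v. f v < p ^ n) \<longrightarrow> set (feats p n (Conj \<phi> \<psi>) f) \<subseteq> {..(C + D) + n}"
    by (force simp: subset_iff)
  then show ?case by blast
next
  case (Disj \<phi> \<psi>)
  then obtain C D where
    "\<forall>n f. (\<forall>v. f v < p ^ n) \<longrightarrow> set (feats p n \<phi> f) \<subseteq> {..C + n}"
    "\<forall>n f. (\<forall>v. f v < p ^ n) \<longrightarrow> set (feats p n \<psi> f) \<subseteq> {..D + n}" by blast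
  then have "\<forall>n f. (\<forall>v. f v < p ^ n) \<longrightarrow> set (feats p n (Disj \<phi> \<psi>) f) \<subseteq> {..(C + D) + n}"
    by (force simp: subset_iff)
  then show ?case by blast
qed auto

section \<open>Splicing two assignments\<close>

text \<open>Terms are affine, and \<open>h\<close> is the linear part of \<open>t\<close> at
  \<open>g\<close>. Since \<open>h\<close> does not depend on \<open>f\<close>, the low parts can be
  exchanged under the same high parts.\<close>

lemma eval_trm_affine: "\<exists>h. \<forall>f. eval_trm (\<lambda>v. f v + c * g v) t = eval_trm f t + c * h"
proof (induction t)
  case (Plus s t)
  then obtain h k where
    "\<forall>f. eval_trm (\<lambda>v. f v + c * g v) s = eval_trm f s + c * h"
    "\<forall>f. eval_trm (\<lambda>v. f v + c * g v) t = eval_trm f t + c * k" by blast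
  then show ?case by (intro exI[of _ "h + k"]) (simp add: algebra_simps)
qed (auto intro: exI[of _ 0])

text \<open>The doubled form also shows that the two values of \<open>t\<close> have an even
  sum.\<close>

lemma eval_trm_midpoint:
  assumes "\<And>v. even (f v + f' v)"
  shows "2 * eval_trm (\<lambda>v. (f v + f' v) div 2) t = eval_trm f t + eval_trm f' t"
  using assms by (induction t) auto

definition low :: "nat \<Rightarrow> nat \<Rightarrow> (nat \<Rightarrow> nat) \<Rightarrow> nat \<Rightarrow> nat" where
  "low p n e v = e v mod p ^ n"

text \<open>Only \<open>e\<close> supplies high parts: those of \<open>e'\<close> may be unrelated,
  and no feature records them.\<close>

definition splice :: "nat \<Rightarrow> nat \<Rightarrow> (nat \<Rightarrow> nat) \<Rightarrow> (nat \<Rightarrow> nat) \<Rightarrow> nat \<Rightarrow> nat" where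
  "splice p n e e' v = (low p n e v + low p n e' v) div 2 + p ^ n * (e v div p ^ n)"

text \<open>With equal carries, averaging the low parts averages the rests and leaves the carry
  alone, so \<open>e\<close> and the splice give \<open>t\<close> the same high part
  \<open>h\<close>.\<close>

lemma eval_trm_splice:
  assumes ev: "\<And>v. even (low p n e v + low p n e' v)"
    and carry: "carry p n t (low p n e) = carry p n t (low p n e')"
  obtains h where "eval_trm e t = rest p n t (low p n e) + p ^ n * h"
    and "eval_trm (splice p n e e') t =
           (rest p n t (low p n e) + rest p n t (low p n e')) div 2 + p ^ n * h"
    and "even (rest p n t (low p n e) + rest p n t (low p n e'))"
proof -
  let ?f = "low p n e" and ?f' = "low p n e'" and ?P = "p ^ n"
  let ?c = "carry p n t ?f" and ?r = "rest p n t ?f" and ?r' = "rest p n t ?f'"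
  obtain h where h: "eval_trm (\<lambda>v. f v + ?P * (e v div ?P)) t = eval_trm f t + ?P * h" for f
    using eval_trm_affine[of ?P "\<lambda>v. e v div ?P" t] by blast
  have f: "eval_trm ?f t = ?r + ?P * ?c" by (simp add: rest_def carry_def)
  have f': "eval_trm ?f' t = ?r' + ?P * ?c" unfolding carry by (simp add: rest_def carry_def)
  have m: "2 * eval_trm (\<lambda>v. (?f v + ?f' v) div 2) t = ?r + ?r' + 2 * (?P * ?c)"
    using eval_trm_midpoint[of ?f ?f' t, OF ev] f f' by simp
  have "even (?r + ?r' + 2 * (?P * ?c))" unfolding m[symmetric] by simp
  then have even: "even (?r + ?r')" by simp
  have "eval_trm (\<lambda>v. (?f v + ?f' v) div 2) t = (?r + ?r') div 2 + ?P * ?c"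
    using m even by (auto elim!: evenE)
  then have "eval_trm (splice p n e e') t = (?r + ?r') div 2 + ?P * (?c + h)"
    using h[of "\<lambda>v. (?f v + ?f' v) div 2"] by (simp add: splice_def[abs_def] algebra_simps)
  moreover have "eval_trm e t = ?r + ?P * (?c + h)"
    using h[of ?f] f by (simp add: low_def algebra_simps)
  ultimately show ?thesis using that even by blast
qed

text \<open>Each atom depends on high parts, which are unchanged, and on relations between rests,
  which the features carry over to midpoints.\<close>

lemma sat_splice:
  assumes p: "p \<ge> 2" and ev: "\<And>v. even (low p n e v + low p n e' v)"
    and "qfree \<psi>" and "feats p n \<psi> (low p n e) = feats p n \<psi> (low p n e')"
  shows "sat p (splice p n e e') \<psi> \<longleftrightarrow> sat p e \<psi>"
  using assms(3,4)
proof (induction \<psi>)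
  case (Equal s t)
  let ?r = "\<lambda>t. rest p n t (low p n e)" and ?r' = "\<lambda>t. rest p n t (low p n e')"
  have lt: "?r t < p ^ n" "?r' t < p ^ n" for t using p by (simp_all add: rest_def)
  have eq: "a + p ^ n * x = b + p ^ n * y \<longleftrightarrow> a = b \<and> x = y"
    if "a < p ^ n" "b < p ^ n" for a b x y
    using that by (metis add_right_cancel div_mult_self2 div_less add_0 mod_less mod_mult_self2 p
        less_nat_zero_code)
  obtain h where h: "eval_trm e s = ?r s + p ^ n * h"
     "eval_trm (splice p n e e') s = (?r s + ?r' s) div 2 + p ^ n * h" "even (?r s + ?r' s)"
    using eval_trm_splice[OF ev, of s] Equal.prems by auto
  obtain k where k: "eval_trm e t = ?r t + p ^ n * k"
     "eval_trm (splice p n e e') t = (?r t + ?r' t) div 2 + p ^ n * k" "even (?r t + ?r' t)"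
    using eval_trm_splice[OF ev, of t] Equal.prems by auto
  have "(?r s + ?r' s) div 2 = (?r t + ?r' t) div 2 \<longleftrightarrow> ?r s = ?r t"
    using cmp_midpoint h(3) k(3) Equal.prems by simp
  moreover have "(?r s + ?r' s) div 2 < p ^ n" "(?r t + ?r' t) div 2 < p ^ n"
    using lt[of s] lt[of t] by linarith+
  ultimately show ?case using h k lt eq by simp
next
  case (V s t)
  let ?r = "\<lambda>t. rest p n t (low p n e)" and ?r' = "\<lambda>t. rest p n t (low p n e')"
  have lt: "?r t < p ^ n" "?r' t < p ^ n" for t using p by (simp_all add: rest_def)
  have mid: "(?r s + ?r' s) div 2 < p ^ n" "(?r t + ?r' t) div 2 < p ^ n"
    using lt[of s] lt[of t] by linarith+
  obtain h where h: "eval_trm e s = ?r s + p ^ n * h"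
     "eval_trm (splice p n e e') s = (?r s + ?r' s) div 2 + p ^ n * h" "even (?r s + ?r' s)"
    using eval_trm_splice[OF ev, of s] V.prems by auto
  obtain k where k: "eval_trm e t = ?r t + p ^ n * k"
     "eval_trm (splice p n e e') t = (?r t + ?r' t) div 2 + p ^ n * k" "even (?r t + ?r' t)"
    using eval_trm_splice[OF ev, of t] V.prems by auto
  have z: "(?r s + ?r' s) div 2 = 0 \<longleftrightarrow> ?r s = 0" "(?r t + ?r' t) div 2 = 0 \<longleftrightarrow> ?r t = 0"
    using cmp_midpoint[of "?r s" 0 "?r' s" 0] cmp_midpoint[of "?r t" 0 "?r' t" 0]
      h(3) k(3) V.prems by simp_all
  \<comment> \<open>For a zero rest of \<open>t\<close>, \<open>V_rel_split\<close> asks only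
    whether the rest of \<open>s\<close> vanishes and about the high parts; this leaves the nonzero
    case.\<close>
  have "V_rel p ((?r s + ?r' s) div 2) ((?r t + ?r' t) div 2) \<longleftrightarrow> V_rel p (?r s) (?r t)"
    if nz: "?r t \<noteq> 0"
  proof -
    let ?k = "multiplicity p (?r t)"
    have k': "multiplicity p (?r' t) = ?k" using V.prems by simp
    have nz': "?r' t \<noteq> 0" using nz V.prems by (auto simp: cmp_def split: if_splits)
    have "multiplicity p ((?r t + ?r' t) div 2) = ?k"
      using multiplicity_midpoint[OF p, of "?r t" "?r' t" ?k] nz nz' k' V.prems by simp
    \<comment> \<open>Both rests of \<open>s\<close> are compared with the same power, which is its
      own midpoint.\<close>
    moreover have "(?r s + ?r' s) div 2 = (p ^ ?k + p ^ ?k) div 2 \<longleftrightarrow> ?r s = p ^ ?k"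
      using k' V.prems h(3) by (intro cmp_midpoint) simp_all
    moreover have "(p ^ ?k + p ^ ?k) div 2 = p ^ ?k" by (simp flip: mult_2)
    moreover have "(?r t + ?r' t) div 2 > 0" "?r t > 0" using nz z(2) by auto
    ultimately show ?thesis by (simp only: V_rel_iff_multiplicity[OF p])
  qed
  then show ?case
    using z h k V_rel_split[OF p mid, of h k] V_rel_split[OF p lt(1) lt(1), of s h t k] by simp
next
  case (Conj \<phi> \<psi>)
  then show ?case by (simp add: length_feats[of p n \<phi> _ p n])
next
  case (Disj \<phi> \<psi>)
  then show ?case by (simp add: length_feats[of p n \<phi> _ p n])
qed auto

section \<open>Existentially definable sets\<close>

lemma sat_foldr_Exists:
  "sat p e (foldr Exists xs \<psi>) \<longleftrightarrow> (\<exists>e'. (\<forall>v. v \<notin> set xs \<longrightarrow> e' v = e v) \<and> sat p e' \<psi>)"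
proof (induction xs arbitrary: e)
  case Nil
  have "(\<forall>v. e' v = e v) \<longleftrightarrow> e' = e" for e' by auto
  then show ?case by simp
next
  case (Cons x xs)
  have "(\<exists>n. \<forall>v. v \<notin> set xs \<longrightarrow> e' v = (e(x := n)) v) \<longleftrightarrow>
        (\<forall>v. v \<notin> set (x # xs) \<longrightarrow> e' v = e v)" for e'
    by auto
  with Cons show ?case by (simp del: fun_upd_apply) blast
qed

text \<open>Taking \<open>N = 2 ^ j\<close> turns both sides into powers of 2 after a crude bound;
  comparing exponents leaves a linear function of \<open>j\<close> against
  \<open>2 ^ j\<close>.\<close>

lemma exists_power_less_exp: "\<exists>N. (C + 2 * N) ^ L < (2::nat) ^ N"
proof -
  \<comment> \<open>Large enough for \<open>C + 2 + j \<le> 3 * m \<le> 2 ^ m\<close> and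
    \<open>L < 2 ^ m\<close> with \<open>j = 2 * m\<close>.\<close>
  define m where "m = L + C + 4"
  define j where "j = 2 * m"
  have three: "3 * k \<le> 2 ^ k" if "k \<ge> 4" for k :: nat
    using that by (induction k rule: nat_induct_at_least) simp_all
  have "3 * m \<le> 2 ^ m" by (rule three) (simp add: m_def)
  moreover have "C + 2 + j \<le> 3 * m" by (simp add: j_def m_def)
  ultimately have "C + 2 + j \<le> 2 ^ m" by linarith
  moreover have "L < m" by (simp add: m_def)
  then have "L < 2 ^ m" using less_exp[of m] by linarith
  ultimately have "(C + 2 + j) * L < 2 ^ m * 2 ^ m" by (intro mult_le_less_imp_less) auto
  then have lt: "(C + 2 + j) * L < 2 ^ j" by (simp add: j_def mult_2 power_add)
  have "C * 1 \<le> 2 ^ C * 2 ^ j" using less_exp[of C] by (intro mult_le_mono) auto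
  moreover have "1 * 2 ^ j \<le> 2 ^ C * (2::nat) ^ j" by (intro mult_le_mono) auto
  ultimately have "C + 2 * 2 ^ j \<le> 4 * (2 ^ C * 2 ^ j)" by linarith
  also have "\<dots> = 2 ^ (C + 2 + j)" by (simp add: power_add)
  finally have "(C + 2 * 2 ^ j) ^ L \<le> (2 ^ (C + 2 + j)) ^ L" by (rule power_mono) simp
  also have "\<dots> = 2 ^ ((C + 2 + j) * L)" by (simp only: power_mult)
  also have "\<dots> < 2 ^ (2 ^ j)" using lt by simp
  finally show ?thesis by blast
qed

lemma Sigma_1_midpoint:
  assumes p: "p \<ge> 2" and S: "S \<in> Sigma_BA 1 p"
    and card: "\<And>N. 2 ^ N \<le> card (S \<inter> {..<p ^ (2 * N)})"
  obtains x y z where "x \<in> S" "y \<in> S" "z \<in> S" "x \<noteq> y" "x + y = 2 * z"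
proof -
  obtain x \<phi> where \<phi>: "is_Sigma 1 \<phi>" and S: "S = {m. sat p ((\<lambda>_. 0)(x := m)) \<phi>}"
    using S by (auto simp: Sigma_BA_def)
  obtain xs \<psi> where \<phi>': "\<phi> = foldr Exists xs \<psi>" and qf: "qfree \<psi>"
    using \<phi> by (auto simp: One_nat_def)
  show ?thesis
  \<comment> \<open>If \<open>x\<close> is itself quantified, the formula ignores \<open>m\<close>,
    so \<open>S\<close> is trivial; the cardinality bound at 0 excludes the empty set.\<close>
  proof (cases "x \<in> set xs")
    case True
    then have "(v \<notin> set xs \<longrightarrow> e' v = ((\<lambda>_. 0)(x := m)) v) \<longleftrightarrow> (v \<notin> set xs \<longrightarrow> e' v = 0)"
      for v m and e' :: "nat \<Rightarrow> nat" by auto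
    then have "S = UNIV \<or> S = {}" unfolding S \<phi>' sat_foldr_Exists by auto
    moreover have "S \<noteq> {}" using card[of 0] by auto
    ultimately show ?thesis using that[of 0 2 1] by simp
  next
    case False
    have "\<exists>e. (\<forall>v. v \<notin> set xs \<longrightarrow> e v = ((\<lambda>_. 0)(x := m)) v) \<and> sat p e \<psi>" if "m \<in> S" for m
      using that unfolding S \<phi>' sat_foldr_Exists by simp
    then obtain e where e: "\<And>m v. m \<in> S \<Longrightarrow> v \<notin> set xs \<Longrightarrow> e m v = ((\<lambda>_. 0)(x := m)) v"
      and sat: "\<And>m. m \<in> S \<Longrightarrow> sat p (e m) \<psi>" by metis
    obtain C where C: "\<And>n f. (\<And>v. f v < p ^ n) \<Longrightarrow> set (feats p n \<psi> f) \<subseteq> {..C + n}"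
      using feats_le[OF p, of \<psi>] by blast
    \<comment> \<open>Besides the features, the parities of \<open>x\<close> and the quantified
      variables are recorded; all other variables are 0 in the chosen assignments.\<close>
    define L where "L = length (feats p 0 \<psi> (\<lambda>_. 0)) + Suc (length xs)"
    obtain N where N: "(C + 2 + 2 * N) ^ L < 2 ^ N" using exists_power_less_exp by blast
    define n where "n = 2 * N"
    define A where "A = S \<inter> {..<p ^ n}"
    define F where "F m = feats p n \<psi> (low p n (e m)) @ map (\<lambda>v. low p n (e m) v mod 2) (x # xs)"
      for m
    have "F m \<in> {ys. set ys \<subseteq> {..<C + 2 + n} \<and> length ys = L}" for m
    proof -
      have "set (feats p n \<psi> (low p n (e m))) \<subseteq> {..C + n}"
        using p by (intro C) (simp add: low_def)
      moreover have "length (F m) = L"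
        by (simp add: F_def L_def length_feats[of p n \<psi> "low p n (e m)" p 0 "\<lambda>_. 0"])
      moreover have "w mod 2 < C + 2 + n" for w :: nat
        by (rule less_le_trans[of _ 2]) auto
      ultimately show ?thesis by (auto simp: F_def)
    qed
    then have sub: "F ` A \<subseteq> {ys. set ys \<subseteq> {..<C + 2 + n} \<and> length ys = L}" by blast
    have "card (F ` A) \<le> (C + 2 + n) ^ L"
      using card_mono[OF finite_lists_length_eq sub] card_lists_length_eq[of "{..<C + 2 + n}" L]
      by simp
    also have "\<dots> < card A" using N card[of N] by (simp add: A_def n_def)
    finally obtain a b where ab: "a \<in> A" "b \<in> A" "a \<noteq> b" "F a = F b"
      using pigeonhole[of F A] by (auto simp: inj_on_def)
    then have aS: "a \<in> S" "b \<in> S" "a < p ^ n" "b < p ^ n" by (auto simp: A_def)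
    have feq: "feats p n \<psi> (low p n (e a)) = feats p n \<psi> (low p n (e b))"
      and par: "\<And>v. v \<in> insert x (set xs) \<Longrightarrow> low p n (e a) v mod 2 = low p n (e b) v mod 2"
      using ab(4) by (auto simp: F_def length_feats[of p n \<psi> "low p n (e a)" p n "low p n (e b)"])
    have ev: "even (low p n (e a) v + low p n (e b) v)" for v
    proof (cases "v \<in> insert x (set xs)")
      case True
      then show ?thesis using par[OF True] by (metis even_add even_iff_mod_2_eq_zero)
    next
      case False
      then show ?thesis using e aS by (simp add: low_def)
    qed
    define c where "c = splice p n (e a) (e b)"
    have "sat p c \<psi>" using sat_splice[OF p ev qf feq] sat aS by (simp add: c_def)
    moreover have "c v = 0" if "v \<notin> insert x (set xs)" for v
      using that e aS by (simp add: c_def splice_def low_def)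
    moreover have exa: "e a x = a" "e b x = b" using e aS False by simp_all
    \<comment> \<open>As \<open>a\<close> and \<open>b\<close> lie below \<open>p ^ n\<close>, the
      value at \<open>x\<close> has no high part, so the splice takes exactly their midpoint. The
      witnesses for \<open>xs\<close> may be arbitrarily large.\<close>
    then have "c x = (a + b) div 2" using aS by (simp add: c_def splice_def low_def)
    ultimately have "(a + b) div 2 \<in> S" unfolding S \<phi>' mem_Collect_eq sat_foldr_Exists
      by (intro exI[of _ c]) auto
    moreover have "even (a + b)" using ev[of x] exa aS by (simp add: low_def)
    ultimately show ?thesis using that[of a b "(a + b) div 2"] aS ab(3) by simp
  qed
qed

lemma zero_one_not_Sigma_1:
  assumes "p \<ge> 2"
  shows "zero_one (p\<^sup>2) \<notin> Sigma_BA 1 p"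
proof
  assume S: "zero_one (p\<^sup>2) \<in> Sigma_BA 1 p"
  have "2 * 2 \<le> p\<^sup>2" unfolding power2_eq_square using assms by (intro mult_le_mono)
  then have q: "p\<^sup>2 \<ge> 3" by simp
  have "2 ^ N \<le> card (zero_one (p\<^sup>2) \<inter> {..<p ^ (2 * N)})" for N
    using card_zero_one_ge[of "p\<^sup>2" N] q by (simp add: power_mult)
  from Sigma_1_midpoint[OF assms S this] zero_one_no_midpoint[OF q] show False by metis
qed

theorem theorem1:
  "(\<forall>p\<ge>2. Sigma_BA 1 p \<noteq> BA p) \<and>
   (\<exists>L. L \<subseteq> lists {0, 1} \<and> regular {0, 1} L \<and>
        (\<forall>p\<ge>2. word_val p ` L \<in> BA p - Sigma_BA 1 p))"
proof -
  have "word_val p ` padded \<in> BA p - Sigma_BA 1 p" if "p \<ge> 2" for p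
    using that zero_one_in_BA zero_one_not_Sigma_1 by (simp add: word_val_padded)
  moreover have "padded \<subseteq> lists {0, 1}" by (auto simp: padded_def)
  ultimately show ?thesis using regular_padded by blast
qed

end
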